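(* Let $t\ge 5$ be an odd integer and let $d$ be an integer with $d\ge t-3$. Then $$\chi_d(G_t)=1+t\left(d-\frac{t-3}{2}\right).$$
   Context: For an odd integer $t\ge 3$, $G_t$ denotes the integer distance graph $G(\mathbb{Z},\{2,t\})$: its vertex set is $\mathbb{Z}$, and distinct $i,j\in\mathbb{Z}$ are adjacent if and only if $|i-j|\in\{2,t\}$. For a graph $G$ and a positive integer $d$, a $d$-distance $k$-coloring is a map $f:V(G)\to\{1,\ldots,k\}$ such that any two distinct vertices $u,v$ with $f(u)=f(v)$ satisfy $d_G(u,v)>d$ ($d_G$ the shortest-path distance); $\chi_d(G)$ is the smallest such $k$. *)

theory Defs
  imports Main "HOL-Library.Extended_Nat"
begin

text \<open>
  A graph is given by its adjacency relation; its vertex set is the whole underlying type.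
\<close>

definition graph_path :: "('a \<Rightarrow> 'a \<Rightarrow> bool) \<Rightarrow> 'a list \<Rightarrow> bool" where
  "graph_path adj xs \<longleftrightarrow> xs \<noteq> [] \<and> distinct xs \<and> successively adj xs"

text \<open>
  A path with list of vertices \<open>xs\<close> has \<open>length xs - 1\<close> edges. Vertices not joined by a path
  are at distance \<open>\<infinity>\<close>, the infimum of the empty set.
\<close>

definition graph_dist :: "('a \<Rightarrow> 'a \<Rightarrow> bool) \<Rightarrow> 'a \<Rightarrow> 'a \<Rightarrow> enat" where
  "graph_dist adj u v =
     Inf {enat (length xs - 1) | xs. graph_path adj xs \<and> hd xs = u \<and> last xs = v}"

definition distance_coloring ::
    "('a \<Rightarrow> 'a \<Rightarrow> bool) \<Rightarrow> nat \<Rightarrow> nat \<Rightarrow> ('a \<Rightarrow> nat) \<Rightarrow> bool" where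
  "distance_coloring adj d k f \<longleftrightarrow>
     (\<forall>v. f v \<in> {1..k}) \<and>
     (\<forall>u v. u \<noteq> v \<and> f u = f v \<longrightarrow> graph_dist adj u v > enat d)"

text \<open>
  The value is \<open>\<infinity>\<close> if no finite number of colours suffices; otherwise the infimum is attained.
\<close>

definition distance_chromatic_number :: "('a \<Rightarrow> 'a \<Rightarrow> bool) \<Rightarrow> nat \<Rightarrow> enat" where
  "distance_chromatic_number adj d = Inf {enat k | k. \<exists>f. distance_coloring adj d k f}"

definition integer_distance_graph :: "int set \<Rightarrow> int \<Rightarrow> int \<Rightarrow> bool" where
  "integer_distance_graph D i j \<longleftrightarrow> i \<noteq> j \<and> \<bar>i - j\<bar> \<in> D"

definition G :: "nat \<Rightarrow> int \<Rightarrow> int \<Rightarrow> bool" where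
  "G t = integer_distance_graph {2, int t}"

end

theory Submission
  imports Defs
begin

text \<open>
  Write \<open>q = (t - 3) / 2\<close> and \<open>D = d - q\<close>. Vertices \<open>u\<close>, \<open>v\<close> are within distance \<open>d\<close> iff
  \<open>v - u = t a + 2 b\<close> with \<open>\<bar>a\<bar> + \<bar>b\<bar> \<le> d\<close>. No nonzero multiple of \<open>1 + t D\<close> has such a
  representation, so the residues modulo \<open>1 + t D\<close> give a colouring. Conversely, all of
  \<open>1, \<dots>, t D\<close> have one as soon as \<open>D \<ge> 2\<close>, so \<open>{0..t D}\<close> needs pairwise distinct colours.
  The hypothesis \<open>d \<ge> t - 3\<close> leaves only \<open>t = 5\<close>, \<open>d = 2\<close> with \<open>D < 2\<close>; there two consecutive
  integers may share a colour, and a hypothetical 5-colouring is excluded separately.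
\<close>

section \<open>Distances measured by walks\<close>

lemma relpowp_imp_graph_path:
  assumes "(adj ^^ n) u v"
  shows "\<exists>xs. graph_path adj xs \<and> hd xs = u \<and> last xs = v \<and> length xs - 1 \<le> n"
  using assms
proof (induction n arbitrary: u)
  case 0
  then show ?case by (intro exI[of _ "[u]"]) (auto simp: graph_path_def)
next
  case (Suc n)
  obtain w where w: "adj u w" "(adj ^^ n) w v"
    using Suc.prems by (meson relpowp_Suc_D2)
  obtain xs where xs: "xs \<noteq> []" "distinct xs" "successively adj xs" "hd xs = w" "last xs = v"
    "length xs - 1 \<le> n"
    using Suc.IH[OF w(2)] by (auto simp: graph_path_def)
  show ?case
  proof (cases "u \<in> set xs")
    case True
    \<comment> \<open>The walk returns to \<open>u\<close>; cutting off the closed part before that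
      occurrence keeps the vertices distinct.\<close>
    then obtain ys zs where s: "xs = ys @ u # zs" by (meson split_list)
    show ?thesis
      using xs s by (intro exI[of _ "u # zs"]) (auto simp: graph_path_def successively_append_iff)
  next
    case False
    show ?thesis
      using xs w False
      by (intro exI[of _ "u # xs"]) (auto simp: graph_path_def successively_Cons)
  qed
qed

lemma successively_imp_relpowp:
  assumes "xs \<noteq> []" and "successively adj xs"
  shows "(adj ^^ (length xs - 1)) (hd xs) (last xs)"
  using assms
proof (induction xs)
  case (Cons x xs)
  show ?case
  proof (cases "xs = []")
    case False
    then have "adj x (hd xs)" and "(adj ^^ (length xs - 1)) (hd xs) (last xs)"
      using Cons by (auto simp: successively_Cons)
    then have "(adj ^^ Suc (length xs - 1)) x (last xs)"
      by (rule relpowp_Suc_I2)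
    then show ?thesis using False by (simp del: relpowp.simps)
  qed simp
qed simp

text \<open>Walks, unlike paths, can be concatenated freely. A walk shortens to a path by removing
  loops, and the infimum is attained because \<open>enat\<close> is well-ordered.\<close>

lemma graph_dist_le_iff:
  "graph_dist adj u v \<le> enat d \<longleftrightarrow> (\<exists>n\<le>d. (adj ^^ n) u v)"
proof -
  let ?S = "{enat (length xs - 1) | xs. graph_path adj xs \<and> hd xs = u \<and> last xs = v}"
  show ?thesis
  proof
    assume le: "graph_dist adj u v \<le> enat d"
    then have "?S \<noteq> {}"
      unfolding graph_dist_def by (metis Inf_enat_def enat_ord_code(5))
    then have "graph_dist adj u v \<in> ?S"
      unfolding graph_dist_def by (meson ex_in_conv wellorder_InfI)
    then obtain xs where "graph_path adj xs" "hd xs = u" "last xs = v" "length xs - 1 \<le> d"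
      using le by auto
    then show "\<exists>n\<le>d. (adj ^^ n) u v"
      using successively_imp_relpowp[of xs adj] by (auto simp: graph_path_def)
  next
    assume "\<exists>n\<le>d. (adj ^^ n) u v"
    then obtain xs where xs: "graph_path adj xs" "hd xs = u" "last xs = v" "length xs - 1 \<le> d"
      using relpowp_imp_graph_path le_trans by metis
    then have "graph_dist adj u v \<le> enat (length xs - 1)"
      unfolding graph_dist_def by (intro Inf_lower) auto
    also have "\<dots> \<le> enat d" using xs by simp
    finally show "graph_dist adj u v \<le> enat d" .
  qed
qed

section \<open>Distances and colourings in \<open>G t\<close>\<close>

lemma relpowp_G_imp_representation:
  assumes "(G t ^^ n) u v"
  shows "\<exists>a b. v - u = int t * a + 2 * b \<and> \<bar>a\<bar> + \<bar>b\<bar> \<le> int n"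
  using assms
proof (induction n arbitrary: v)
  case 0
  then show ?case by (intro exI[of _ 0]) auto
next
  case (Suc n)
  obtain w where w: "(G t ^^ n) u w" "G t w v" using Suc.prems by auto
  obtain a b where ab: "w - u = int t * a + 2 * b" "\<bar>a\<bar> + \<bar>b\<bar> \<le> int n"
    using Suc.IH[OF w(1)] by auto
  consider "v = w + 2" | "v = w - 2" | "v = w + int t" | "v = w - int t"
    using w(2) by (auto simp: G_def integer_distance_graph_def abs_if split: if_splits)
  then show ?case
  proof cases
    case 1
    then show ?thesis using ab by (intro exI[of _ a] exI[of _ "b + 1"]) auto
  next
    case 2
    then show ?thesis using ab by (intro exI[of _ a] exI[of _ "b - 1"]) auto
  next
    case 3
    then show ?thesis
      using ab by (intro exI[of _ "a + 1"] exI[of _ b]) (auto simp: algebra_simps)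
  next
    case 4
    then show ?thesis
      using ab by (intro exI[of _ "a - 1"] exI[of _ b]) (auto simp: algebra_simps)
  qed
qed

lemma relpowp_translation:
  fixes u c :: int
  assumes "\<And>x. adj x (x + c)"
  shows "(adj ^^ n) u (u + int n * c)"
proof (induction n)
  case (Suc n)
  have "adj (u + int n * c) (u + int n * c + c)" by (rule assms)
  then have "(adj ^^ Suc n) u (u + int n * c + c)" using Suc by auto
  then show ?case by (simp add: algebra_simps del: relpowp.simps)
qed simp

lemma relpowp_G_multiple:
  assumes "c = 2 \<or> c = int t" and "t > 0"
  shows "(G t ^^ nat \<bar>a\<bar>) u (u + a * c)"
proof (cases "a \<ge> 0")
  case True
  have "(G t ^^ nat \<bar>a\<bar>) u (u + int (nat \<bar>a\<bar>) * c)"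
    using assms by (intro relpowp_translation) (auto simp: G_def integer_distance_graph_def)
  then show ?thesis using True by simp
next
  case False
  have "(G t ^^ nat \<bar>a\<bar>) u (u + int (nat \<bar>a\<bar>) * (- c))"
    using assms by (intro relpowp_translation) (auto simp: G_def integer_distance_graph_def)
  then show ?thesis using False by simp
qed

text \<open>Adjacency depends only on differences, so the order of steps is irrelevant:
  \<open>a\<close> and \<open>b\<close> are the net numbers of steps \<open>t\<close> and
  \<open>2\<close>. Conversely, all steps of one kind followed by all of the other form a walk of
  length \<open>\<bar>a\<bar> + \<bar>b\<bar>\<close>.\<close>

lemma graph_dist_G_le_iff:
  assumes "t > 0"
  shows "graph_dist (G t) u v \<le> enat d \<longleftrightarrow>
    (\<exists>a b. v - u = int t * a + 2 * b \<and> \<bar>a\<bar> + \<bar>b\<bar> \<le> int d)"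
proof
  assume "graph_dist (G t) u v \<le> enat d"
  then obtain n where "n \<le> d" "(G t ^^ n) u v" by (auto simp: graph_dist_le_iff)
  then show "\<exists>a b. v - u = int t * a + 2 * b \<and> \<bar>a\<bar> + \<bar>b\<bar> \<le> int d"
    using relpowp_G_imp_representation[of n t u v] by fastforce
next
  assume "\<exists>a b. v - u = int t * a + 2 * b \<and> \<bar>a\<bar> + \<bar>b\<bar> \<le> int d"
  then obtain a b where ab: "v - u = int t * a + 2 * b" "\<bar>a\<bar> + \<bar>b\<bar> \<le> int d" by auto
  have "(G t ^^ nat \<bar>a\<bar>) u (u + a * int t)"
    and "(G t ^^ nat \<bar>b\<bar>) (u + a * int t) (u + a * int t + b * 2)"
    using assms by (auto intro!: relpowp_G_multiple)
  then have "(G t ^^ (nat \<bar>a\<bar> + nat \<bar>b\<bar>)) u (u + a * int t + b * 2)"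
    unfolding relpowp_add by blast
  moreover have "u + a * int t + b * 2 = v" using ab by (simp add: algebra_simps)
  moreover have "nat \<bar>a\<bar> + nat \<bar>b\<bar> \<le> d" using ab by linarith
  ultimately show "graph_dist (G t) u v \<le> enat d" by (auto simp: graph_dist_le_iff)
qed

lemma distance_coloring_G_iff:
  assumes "t > 0"
  shows "distance_coloring (G t) d k f \<longleftrightarrow> (\<forall>v. f v \<in> {1..k}) \<and>
    (\<forall>u a b. int t * a + 2 * b \<noteq> 0 \<longrightarrow> \<bar>a\<bar> + \<bar>b\<bar> \<le> int d \<longrightarrow>
      f (u + (int t * a + 2 * b)) \<noteq> f u)"
proof -
  have "(\<forall>u v. u \<noteq> v \<and> f u = f v \<longrightarrow> graph_dist (G t) u v > enat d) \<longleftrightarrow>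
      (\<forall>u v. u \<noteq> v \<and> graph_dist (G t) u v \<le> enat d \<longrightarrow> f u \<noteq> f v)"
    by (metis not_le)
  also have "\<dots> \<longleftrightarrow> (\<forall>u a b. int t * a + 2 * b \<noteq> 0 \<longrightarrow> \<bar>a\<bar> + \<bar>b\<bar> \<le> int d \<longrightarrow>
      f (u + (int t * a + 2 * b)) \<noteq> f u)" (is "?L \<longleftrightarrow> ?R")
  proof
    assume L: ?L
    show ?R
    proof (intro allI impI)
      fix u a b :: int
      assume "int t * a + 2 * b \<noteq> 0" "\<bar>a\<bar> + \<bar>b\<bar> \<le> int d"
      then have "u \<noteq> u + (int t * a + 2 * b)"
        and "graph_dist (G t) u (u + (int t * a + 2 * b)) \<le> enat d"
        by (auto simp: graph_dist_G_le_iff[OF assms])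
      with L show "f (u + (int t * a + 2 * b)) \<noteq> f u" by metis
    qed
  next
    assume R: ?R
    show ?L
    proof (intro allI impI)
      fix u v :: int
      assume uv: "u \<noteq> v \<and> graph_dist (G t) u v \<le> enat d"
      then obtain a b where ab: "v - u = int t * a + 2 * b" "\<bar>a\<bar> + \<bar>b\<bar> \<le> int d"
        by (auto simp: graph_dist_G_le_iff[OF assms])
      then have "v = u + (int t * a + 2 * b)" by simp
      moreover have "int t * a + 2 * b \<noteq> 0" using uv ab(1) by auto
      ultimately show "f u \<noteq> f v" using R ab(2) by metis
    qed
  qed
  finally show ?thesis unfolding distance_coloring_def by simp
qed

section \<open>Arithmetic of the representations \<open>t * a + 2 * b\<close>\<close>

lemma no_short_representation_of_multiple:
  fixes t q D a b m :: int
  assumes t: "t = 2 * q + 3" and "q \<ge> 0" and "q \<le> D" and "m > 0"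
    and rep: "t * a + 2 * b = m * (1 + t * D)"
  shows "D + q < \<bar>a\<bar> + \<bar>b\<bar>"
proof (rule ccontr)
  assume "\<not> ?thesis"
  then have short: "\<bar>a\<bar> + \<bar>b\<bar> \<le> D + q" by simp
  show False
  proof (cases "m = 1")
    case False
    \<comment> \<open>For \<open>m \<ge> 2\<close> size suffices: a short representation has value
      at most \<open>t * (D + q)\<close>, and \<open>q \<le> D\<close> makes this less than
      \<open>2 * (1 + t * D)\<close>.\<close>
    have "t * a \<le> t * \<bar>a\<bar>" using assms(1,2) by (intro mult_left_mono) auto
    moreover have "2 * \<bar>b\<bar> \<le> t * \<bar>b\<bar>" using assms(1,2) by (intro mult_right_mono) auto
    ultimately have "m * (1 + t * D) \<le> t * (\<bar>a\<bar> + \<bar>b\<bar>)"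
      using rep by (simp add: distrib_left)
    also have "\<dots> \<le> t * (2 * D)"
      using short assms by (intro mult_left_mono) auto
    also have "\<dots> < 2 * (1 + t * D)" by simp
    also have "\<dots> \<le> m * (1 + t * D)"
      using False assms by (intro mult_right_mono) auto
    finally show False by simp
  next
    case True
    \<comment> \<open>For \<open>m = 1\<close>, compare with \<open>t * D\<close>, which falls short
      by 1. Correcting this odd amount needs a nonzero change \<open>e\<close> in the number of
      steps \<open>t\<close>.\<close>
    define e where "e = a - D"
    have te: "t * e + 2 * b = 1"
      using rep True by (simp add: e_def algebra_simps)
    consider "e = 0" | "e \<ge> 1" | "e \<le> - 1" by linarith
    then show False
    proof cases
      case 1
      then have "2 * b = 1" using te by simp
      then show False by presburger
    next
      case 2
      \<comment> \<open>Here \<open>2 * b \<le> 1 - t\<close>, so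
        \<open>\<bar>b\<bar> \<ge> q + 1\<close> while
        \<open>\<bar>a\<bar> \<ge> D + 1\<close>.\<close>
      have "t * 1 \<le> t * e" using 2 assms by (intro mult_left_mono) auto
      moreover have "\<bar>a\<bar> = D + e" using 2 assms by (simp add: e_def)
      ultimately show False using te short 2 t by linarith
    next
      case 3
      \<comment> \<open>Removing \<open>- e\<close> steps \<open>t\<close> saves at most
        \<open>- e\<close> but needs \<open>2 * b = 1 - t * e\<close>. The net excess over
        \<open>D\<close> is at least \<open>(1 - (t - 2) * e) / 2\<close>, hence at least
        \<open>q + 1\<close>.\<close>
      have "(t - 2) * 1 \<le> (t - 2) * (- e)" using 3 assms by (intro mult_left_mono) auto
      then have "t - 2 \<le> 2 * e - t * e" by (simp add: algebra_simps)
      then show False using te short t by (auto simp: e_def)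
    qed
  qed
qed

lemma short_representation:
  fixes t q D n :: int
  assumes t: "t = 2 * q + 3" and "q \<ge> 0" and "D \<ge> 2" and "0 \<le> n" and "n \<le> t * D"
  shows "\<exists>a b. n = t * a + 2 * b \<and> \<bar>a\<bar> + \<bar>b\<bar> \<le> D + q"
proof (cases "n = t * D")
  case True
  then show ?thesis using assms by (intro exI[of _ D] exI[of _ 0]) auto
next
  case False
  define A s where "A = n div t" and "s = n mod t"
  have tpos: "t > 0" using assms by simp
  have n: "n = t * A + s" by (simp add: A_def s_def)
  have s: "0 \<le> s" "s < t" using tpos by (auto simp: s_def)
  have A: "0 \<le> A" using assms tpos by (simp add: A_def pos_imp_zdiv_nonneg_iff)
  have "t * A < t * D" using n s False assms(5) by linarith
  then have AD: "A \<le> D - 1" using tpos by simp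
  show ?thesis
  proof (cases "even s")
    case True
    then obtain r where "s = 2 * r" by (elim evenE)
    \<comment> \<open>Since \<open>t\<close> is odd and \<open>s < t\<close>, here
      \<open>r \<le> q + 1\<close>.\<close>
    then show ?thesis using n s A AD t by (intro exI[of _ A] exI[of _ r]) auto
  next
    case False
    then obtain r where r: "s = 2 * r + 1" by (elim oddE)
    show ?thesis
    \<comment> \<open>For odd \<open>s\<close>, overshooting to \<open>t * (A + 1)\<close> and going
      back costs \<open>A + q + 2 - r\<close>. This exceeds \<open>D + q\<close> only for
      \<open>n = t * (D - 1) + 1\<close>, which is rewritten as
      \<open>t * (D - 2) + 2 * (q + 2)\<close>; \<open>D \<ge> 2\<close> keeps the first coefficient
      nonnegative.\<close>
    proof (cases "r = 0 \<and> A = D - 1")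
      case True
      then show ?thesis
        using n r A assms
        by (intro exI[of _ "A - 1"] exI[of _ "q + 2"]) (auto simp: algebra_simps)
    next
      case False
      then show ?thesis
        using n r s A AD t
        by (intro exI[of _ "A + 1"] exI[of _ "r - q - 1"]) (auto simp: algebra_simps)
    qed
  qed
qed

section \<open>The exceptional case \<open>t = 5\<close>, \<open>d = 2\<close>\<close>

lemma card_list_le:
  assumes "finite S" and "distinct xs" and "set xs \<subseteq> S"
  shows "length xs \<le> card S"
  using assms by (metis card_mono distinct_card)

text \<open>The listed differences are those realised within distance 2 in \<open>G 5\<close>. Five
  colours would force a pair of equally coloured consecutive integers to recur with period 7, each
  time in a new colour, until a sixth colour is needed.\<close>

lemma no_five_coloring:
  fixes f :: "int \<Rightarrow> 'c"
  assumes fin: "finite S" and card: "card S \<le> 5" and S: "\<And>v. f v \<in> S"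
    and ne: "\<And>u v. \<bar>u - v\<bar> \<in> {2, 3, 4, 5, 7, 10} \<Longrightarrow> f u \<noteq> f v"
  shows False
proof -
  \<comment> \<open>The closed neighbourhood of any vertex carries all five colours.\<close>
  have all: "f y \<in> {f (c - 5), f (c - 2), f c, f (c + 2), f (c + 5)}" for c y
  proof (rule ccontr)
    assume "\<not> ?thesis"
    then have "distinct [f y, f (c - 5), f (c - 2), f c, f (c + 2), f (c + 5)]"
      by (auto simp: ne)
    from card_list_le[OF fin this] show False using card S by auto
  qed
  \<comment> \<open>The neighbourhood of \<open>y + 3\<close> is \<open>y - 2\<close>,
    \<open>y + 1\<close>, \<open>y + 3\<close>, \<open>y + 5\<close>, \<open>y + 8\<close>; only
    \<open>y + 1\<close> and \<open>y + 8\<close> can share the colour of \<open>y\<close>.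
    \<open>down\<close> is the mirror image.\<close>
  have up: "f y = f (y + 1) \<or> f y = f (y + 8)" for y
    using all[of y "y + 3"] ne[of y "y - 2"] ne[of "y + 3" y] ne[of "y + 5" y]
    by (auto simp: algebra_simps)
  have down: "f y = f (y - 1) \<or> f y = f (y - 8)" for y
    using all[of y "y - 3"] ne[of "y + 2" y] ne[of y "y - 3"] ne[of y "y - 5"]
    by (auto simp: algebra_simps)
  have pair_up: "f (x + 7) = f (x + 8) \<and> f (x - 1) = f (x + 7)" if "f x = f (x + 1)" for x
    using that down[of "x + 8"] up[of "x - 1"] ne[of "x + 8" "x + 1"] ne[of "x + 1" "x - 1"]
    by (auto simp: algebra_simps)
  have pair_down: "f (x - 7) = f (x - 6) \<and> f (x + 2) = f (x - 6)" if "f x = f (x + 1)" for x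
    using that up[of "x - 7"] down[of "x + 2"] ne[of "x + 1" "x - 6"] ne[of x "x - 7"]
      ne[of "x + 2" x]
    by (auto simp: algebra_simps)
  \<comment> \<open>Otherwise difference 1 is forbidden as well, and \<open>0\<close>, ...,
    \<open>5\<close> need six colours.\<close>
  obtain x where x: "f x = f (x + 1)"
  proof (rule ccontr)
    assume "\<not> thesis"
    then have no: "f y \<noteq> f (y + 1)" for y using that by auto
    have "distinct [f 0, f 1, f 2, f 3, f 4, f 5]"
      using no[of 0] no[of 1] no[of 2] no[of 3] no[of 4] by (auto simp: ne)
    from card_list_le[OF fin this] show False using card S by auto
  qed
  have p0: "f (x + 7) = f (x + 8)" "f (x - 1) = f (x + 7)"
    "f (x - 7) = f (x - 6)" "f (x + 2) = f (x - 6)"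
    using pair_up[OF x] pair_down[OF x] by auto
  have p7: "f (x + 14) = f (x + 15)" "f (x + 6) = f (x + 14)"
    using pair_up[of "x + 7"] p0 by (auto simp: algebra_simps)
  \<comment> \<open>The first four colours also occur at \<open>x + 2\<close>, \<open>x + 1\<close>,
    \<open>x + 8\<close> and both \<open>x + 6\<close> and \<open>x + 15\<close>. For every two
    entries, suitable representatives differ by a forbidden amount.\<close>
  have "distinct [f (x - 7), f x, f (x + 7), f (x + 14), f (x + 3), f (x + 5)]"
    using x p0 p7 ne[of "x - 7" x] ne[of "x + 2" "x + 7"] ne[of "x + 2" "x + 6"]
      ne[of "x - 7" "x + 3"] ne[of "x + 2" "x + 5"] ne[of x "x + 7"] ne[of "x + 1" "x + 6"]
      ne[of x "x + 3"] ne[of x "x + 5"] ne[of "x + 7" "x + 14"] ne[of "x + 3" "x + 7"]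
      ne[of "x + 5" "x + 7"] ne[of "x + 3" "x + 6"] ne[of "x + 5" "x + 15"]
      ne[of "x + 3" "x + 5"]
    by auto
  from card_list_le[OF fin this] show False using card S by auto
qed

section \<open>The two bounds on the chromatic number\<close>

theorem theorem8:
  fixes t d :: nat
  assumes "odd t" and "t \<ge> 5" and "d \<ge> t - 3"
  shows "distance_chromatic_number (G t) d = enat (1 + t * (d - (t - 3) div 2))"
proof -
  define q where "q = (t - 3) div 2"
  define D where "D = d - q"
  have t: "t = 2 * q + 3" and q: "q \<ge> 1"
    using assms(1,2) unfolding q_def by presburger+
  \<comment> \<open>The hypothesis reads \<open>d \<ge> 2 * q\<close>: the subtraction in
    \<open>D\<close> is exact, and \<open>q \<le> D\<close> as the residue colouring
    requires.\<close>
  have D: "q \<le> D" "d = D + q" using assms(3) t by (auto simp: D_def)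
  have t': "int t = 2 * int q + 3" using t by simp
  have t0: "t > 0" using t by simp
  define K where "K = 1 + t * D"
  have K: "int K = 1 + int t * int D" by (simp add: K_def)
  have K0: "int K > 0" unfolding K_def of_nat_0_less_iff by simp
  have "distance_coloring (G t) d K (\<lambda>v. nat (v mod int K) + 1)"
    unfolding distance_coloring_G_iff[OF t0]
  proof (intro conjI allI impI notI)
    fix v :: int
    have "v mod int K < int K" "0 \<le> v mod int K" using K0 by simp_all
    then show "nat (v mod int K) + 1 \<in> {1..K}" by auto
  next
    fix u a b :: int
    assume nz: "int t * a + 2 * b \<noteq> 0" and short: "\<bar>a\<bar> + \<bar>b\<bar> \<le> int d"
      and eq: "nat ((u + (int t * a + 2 * b)) mod int K) + 1 = nat (u mod int K) + 1"
    have "0 \<le> w mod int K" for w using K0 by simp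
    then have "(u + (int t * a + 2 * b)) mod int K = u mod int K"
      using eq by (simp add: nat_eq_iff)
    then have "int K dvd int t * a + 2 * b" by (simp add: mod_eq_dvd_iff)
    then obtain m where m: "int t * a + 2 * b = m * int K" by (metis dvd_def mult.commute)
    then have "m \<noteq> 0" using nz by auto
    \<comment> \<open>Negating \<open>a\<close>, \<open>b\<close> and \<open>m\<close> together
      reduces the second case to the first.\<close>
    then consider "m > 0" | "- m > 0" by linarith
    then show False
    proof cases
      case 1
      then show False
        using no_short_representation_of_multiple[of "int t" "int q" "int D" m a b]
          m short t' D K by auto
    next
      case 2
      have "int t * (- a) + 2 * (- b) = - m * int K" using m by simp
      then show False
        using no_short_representation_of_multiple[of "int t" "int q" "int D" "- m" "- a" "- b"]
          2 short t' D K by auto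
    qed
  qed
  then have upper: "distance_chromatic_number (G t) d \<le> enat K"
    unfolding distance_chromatic_number_def by (intro Inf_lower) auto
  have lower: "K \<le> k" if "distance_coloring (G t) d k f" for k f
  proof -
    have range: "f v \<in> {1..k}" for v
      using that by (auto simp: distance_coloring_G_iff[OF t0])
    have ne: "f u \<noteq> f v" if "v - u = int t * a + 2 * b" "u \<noteq> v" "\<bar>a\<bar> + \<bar>b\<bar> \<le> int d" for u v a b
    proof -
      have "v = u + (int t * a + 2 * b)" "int t * a + 2 * b \<noteq> 0" using that(1,2) by auto
      then show ?thesis
        using \<open>distance_coloring (G t) d k f\<close> that(3)
        unfolding distance_coloring_G_iff[OF t0] by metis
    qed
    show ?thesis
    proof (cases "D \<ge> 2")
      case True
      have less: "f u \<noteq> f v" if "0 \<le> u" "u < v" "v \<le> int t * int D" for u v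
        using short_representation[of "int t" "int q" "int D" "v - u"] t' True that ne[of v u] D
        by auto
      have "inj_on f {0..int t * int D}"
      proof (rule inj_onI)
        fix u v
        assume "u \<in> {0..int t * int D}" "v \<in> {0..int t * int D}" "f u = f v"
        then show "u = v" using less[of u v] less[of v u] by (cases u v rule: linorder_cases) auto
      qed
      then have "card {0..int t * int D} \<le> card {1..k}"
        using range by (intro card_inj_on_le[of f]) auto
      then show ?thesis by (simp add: K_def nat_add_distrib nat_mult_distrib)
    next
      case False
      \<comment> \<open>\<open>1 \<le> q \<le> D < 2\<close> leaves a single pair \<open>t\<close>,
        \<open>d\<close>.\<close>
      then have vals: "q = 1" "D = 1" "t = 5" "d = 2" using q D t by auto
      \<comment> \<open>The witnesses are \<open>2\<close>, \<open>5 - 2\<close>,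
        \<open>2 * 2\<close>, \<open>5\<close>, \<open>5 + 2\<close> and
        \<open>2 * 5\<close>.\<close>
      have up: "f u \<noteq> f v" if "v - u \<in> {2, 3, 4, 5, 7, 10}" for u v
        using that ne[of v u 0 1] ne[of v u 1 "- 1"] ne[of v u 0 2] ne[of v u 1 0]
          ne[of v u 1 1] ne[of v u 2 0]
        by (auto simp: vals)
      have "f u \<noteq> f v" if "\<bar>u - v\<bar> \<in> {2, 3, 4, 5, 7, 10}" for u v
        using that up[of v u] up[of u v] by (cases "u \<le> v") auto
      then have "\<not> card {1..k} \<le> 5"
        using no_five_coloring[of "{1..k}" f] range by blast
      then show ?thesis by (simp add: K_def vals)
    qed
  qed
  have "enat K \<le> distance_chromatic_number (G t) d"
    unfolding distance_chromatic_number_def by (intro Inf_greatest) (auto dest: lower)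
  with upper show ?thesis by (simp add: K_def D_def q_def)
qed

end
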